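(* Let $\delta=(x^2-1)D^2+2xD$, where $D=d/dx$, acting on $\mathbb{R}[x]$, and fix positive integers $n$ and $N$. Let $A_1,\dots,A_N$ be real numbers with $-(n+1)\le A_j\le n(n+1)$ for all $j\in\{1,\dots,N\}$. Then the operator $$\delta(\delta-1\cdot 2)(\delta-2\cdot 3)\cdots\big(\delta-(n-1)n\big)\prod_{j=1}^{N}(\delta-A_j)$$ is a hyperbolicity preserver.
   Context: A polynomial in $\mathbb{R}[x]$ is called hyperbolic if all of its zeros are real; by convention the zero polynomial is hyperbolic (and so are nonzero constants). An operator on $\mathbb{R}[x]$ is a hyperbolicity preserver if it maps every hyperbolic polynomial to a hyperbolic polynomial. Products of operators denote composition, and a real number $A$ in an expression such as $\delta-A$ denotes $A$ times the identity operator. The factors preceding $\prod_{j=1}^N$ are $\delta-i(i+1)$ for $i=0,1,\dots,n-1$. *)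

theory Defs
  imports "HOL-Analysis.Analysis" "HOL-Computational_Algebra.Polynomial"
begin

text \<open>Every complex number is a zero of the zero polynomial, which is hyperbolic by convention.\<close>

definition hyperbolic :: "real poly \<Rightarrow> bool" where
  "hyperbolic p \<longleftrightarrow>
     p = 0 \<or> (\<forall>z::complex. poly (map_poly complex_of_real p) z = 0 \<longrightarrow> z \<in> \<real>)"

definition hyperbolicity_preserver :: "(real poly \<Rightarrow> real poly) \<Rightarrow> bool" where
  "hyperbolicity_preserver T \<longleftrightarrow> (\<forall>p. hyperbolic p \<longrightarrow> hyperbolic (T p))"

definition legendre_op :: "real poly \<Rightarrow> real poly" ("\<delta>") where
  "\<delta> p = [:-1, 0, 1:] * pderiv (pderiv p) + [:0, 2:] * pderiv p"

definition delta_minus :: "real \<Rightarrow> real poly \<Rightarrow> real poly" where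
  "delta_minus A p = \<delta> p - smult A p"

definition op_prod :: "('a \<Rightarrow> 'a) list \<Rightarrow> 'a \<Rightarrow> 'a" where
  "op_prod Ts = foldr (\<circ>) Ts id"

end

theory Submission
  imports Defs "HOL-Computational_Algebra.Fundamental_Theorem_Algebra"
begin

text \<open>
  With \<open>D = d/dx\<close> one has
  \<open>\<Prod>i<n. (\<delta> - i (i + 1)) = D\<^sup>n (x\<^sup>2 - 1)\<^sup>n D\<^sup>n\<close> and
  \<open>D\<^sup>n (\<delta> - A) = L D\<^sup>n\<close>, where \<open>L = (x\<^sup>2 - 1) D\<^sup>2 + 2 m x D + B\<close> with \<open>m = n + 1\<close> and
  \<open>B = n (n + 1) - A\<close>; the bounds on \<open>A\<close> say exactly that \<open>0 \<le> B \<le> m\<^sup>2\<close>.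
  It remains to see that such an \<open>L\<close> preserves hyperbolicity. If \<open>f\<close> has the real zeros
  \<open>a\<^sub>i\<close> and \<open>Im z > 0\<close>, put \<open>t\<^sub>i = 1/(z - a\<^sub>i)\<close>, \<open>p = 1/(z - 1)\<close>, \<open>q = 1/(z + 1)\<close>.
  Then \<open>p q L f(z) / f(z)\<close> is the quadratic form
  \<open>(\<Sum>t\<^sub>i)\<^sup>2 - \<Sum>t\<^sub>i\<^sup>2 + m (p + q) \<Sum>t\<^sub>i + B p q\<close>.
  It has a single positive square when \<open>0 \<le> B \<le> m\<^sup>2\<close> and nonnegative coefficients as a
  polynomial, so by the reversed Cauchy--Schwarz inequality it has no zero all of whose
  coordinates lie in the open lower half-plane.
\<close>

section \<open>Lorentzian quadratic forms\<close>

text \<open>For the Lorentzian form, the real and imaginary parts of \<open>(u, l)\<close> are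
  orthogonal and have equal norm. If the norm were positive, two timelike vectors would be
  orthogonal, which Cauchy-Schwarz forbids.\<close>

lemma square_eq_sum_squares_Im_le:
  fixes u :: complex and l :: "'i \<Rightarrow> complex"
  assumes eq: "u\<^sup>2 = (\<Sum>i\<in>I. (l i)\<^sup>2)"
  shows "(Im u)\<^sup>2 \<le> (\<Sum>i\<in>I. (Im (l i))\<^sup>2)"
proof (rule ccontr)
  define X where "X = (\<Sum>i\<in>I. (Re (l i))\<^sup>2)"
  define Y where "Y = (\<Sum>i\<in>I. (Im (l i))\<^sup>2)"
  define Z where "Z = (\<Sum>i\<in>I. Re (l i) * Im (l i))"
  assume "\<not> ?thesis"
  then have less: "Y < (Im u)\<^sup>2" by (simp add: Y_def)
  have re: "(Re u)\<^sup>2 - (Im u)\<^sup>2 = X - Y"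
    using arg_cong[OF eq, of Re] by (simp add: X_def Y_def sum_subtractf Re_power2)
  have "2 * (Re u * Im u) = 2 * Z"
    using arg_cong[OF eq, of Im] by (simp add: Z_def sum_distrib_left Im_power2 mult.assoc)
  then have im: "Re u * Im u = Z" by simp
  have nonneg: "0 \<le> X" "0 \<le> Y" unfolding X_def Y_def by (auto intro: sum_nonneg)
  have "Z\<^sup>2 \<le> X * Y"
    unfolding X_def Y_def Z_def by (rule Cauchy_Schwarz_ineq_sum)
  also have "\<dots> \<le> X * (Im u)\<^sup>2"
    using less nonneg by (intro mult_left_mono) auto
  \<comment> \<open>By \<open>re\<close>, \<open>Y < (Im u)^2\<close> also gives
    \<open>X < (Re u)^2\<close>.\<close>
  also have "\<dots> < (Re u)\<^sup>2 * (Im u)\<^sup>2"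
    using less nonneg re by (intro mult_strict_right_mono) auto
  also have "\<dots> = Z\<^sup>2" by (simp flip: im add: power_mult_distrib)
  finally show False by simp
qed

lemma quadratic_form_nonzero_lower_half_plane:
  fixes t :: "nat \<Rightarrow> complex" and p q :: complex and m B :: real
  assumes "d > 0" and t: "\<And>i. i < d \<Longrightarrow> Im (t i) < 0"
    and p: "Im p < 0" and q: "Im q < 0"
    and m: "m > 0" and B: "0 \<le> B" "B \<le> m\<^sup>2"
  defines "S \<equiv> \<Sum>i<d. t i"
  shows "S\<^sup>2 - (\<Sum>i<d. (t i)\<^sup>2) + m * (p + q) * S + B * p * q \<noteq> 0"
proof
  assume zero: "S\<^sup>2 - (\<Sum>i<d. (t i)\<^sup>2) + m * (p + q) * S + B * p * q = 0"
  \<comment> \<open>Completing the square in \<open>S\<close> leaves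
    \<open>B p q - m^2/4 (p + q)^2\<close>. Since \<open>4 p q = (p + q)^2 - (p - q)^2\<close>, this
    is \<open>- b^2 (p - q)^2 - c^2 (p + q)^2\<close>; the bounds on \<open>B\<close> make
    \<open>b\<close> and \<open>c\<close> real.\<close>
  define b where "b = sqrt B / 2"
  define c where "c = sqrt (m\<^sup>2 - B) / 2"
  have b2: "b\<^sup>2 = B / 4" and c2: "c\<^sup>2 = (m\<^sup>2 - B) / 4"
    using B by (simp_all add: b_def c_def power_divide)
  define l where
    "l i = (if i < d then t i else if i = d then b * (p - q) else c * (p + q))" for i
  define u where "u = S + of_real (m / 2) * (p + q)"
  have split: "(\<Sum>i<Suc (Suc d). g (l i)) = (\<Sum>i<d. g (t i)) + g (b * (p - q)) + g (c * (p + q))"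
    for g :: "complex \<Rightarrow> 'a::comm_monoid_add"
    by (simp add: l_def)
  have b2c: "(complex_of_real b)\<^sup>2 = B / 4" and c2c: "(complex_of_real c)\<^sup>2 = (m\<^sup>2 - B) / 4"
    by (simp_all flip: of_real_power add: b2 c2)
  have "u\<^sup>2 - (\<Sum>i<Suc (Suc d). (l i)\<^sup>2)
      = S\<^sup>2 - (\<Sum>i<d. (t i)\<^sup>2) + m * (p + q) * S + B * p * q"
    unfolding split[of "\<lambda>x. x\<^sup>2"] u_def power_mult_distrib b2c c2c
    by (simp add: field_simps power2_eq_square)
  then have "u\<^sup>2 = (\<Sum>i<Suc (Suc d). (l i)\<^sup>2)" using zero by simp
  from square_eq_sum_squares_Im_le[OF this]
  have le: "(Im u)\<^sup>2 \<le> (\<Sum>i<Suc (Suc d). (Im (l i))\<^sup>2)" .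
  define s P Q where "s = (\<Sum>i<d. - Im (t i))" and "P = - Im p" and "Q = - Im q"
  have PQ: "P > 0" "Q > 0" using p q by (simp_all add: P_def Q_def)
  have spos: "s > 0"
    unfolding s_def using \<open>d > 0\<close> t by (intro sum_pos) auto
  have "(\<Sum>i<d. (Im (t i))\<^sup>2) = (\<Sum>i<d. (- Im (t i)) * (- Im (t i)))"
    by (simp add: power2_eq_square)
  also have "\<dots> \<le> (\<Sum>i<d. (- Im (t i)) * s)"
  proof (intro sum_mono mult_left_mono)
    fix i assume i: "i \<in> {..<d}"
    show "- Im (t i) \<le> s"
      unfolding s_def using i t by (intro member_le_sum[of i _ "\<lambda>i. - Im (t i)"]) (auto intro: less_imp_le)
    show "0 \<le> - Im (t i)" using i t by (auto intro: less_imp_le)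
  qed
  also have "\<dots> = s\<^sup>2" by (simp only: s_def power2_eq_square flip: sum_distrib_right)
  finally have sq: "(\<Sum>i<d. (Im (t i))\<^sup>2) \<le> s\<^sup>2" .
  have "Im u = - (s + m / 2 * (P + Q))"
    by (simp add: u_def S_def s_def P_def Q_def sum_negf algebra_simps)
  then have Imu: "(Im u)\<^sup>2 = (s + m / 2 * (P + Q))\<^sup>2" by (simp only: power2_minus)
  have bP: "(Im (b * (p - q)))\<^sup>2 = B / 4 * (P - Q)\<^sup>2"
    by (simp add: P_def Q_def power_mult_distrib b2 power2_commute)
  have cP: "(Im (c * (p + q)))\<^sup>2 = (m\<^sup>2 - B) / 4 * (P + Q)\<^sup>2"
    by (simp add: P_def Q_def power_mult_distrib c2) (simp add: power2_eq_square algebra_simps)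
  have "(s + m / 2 * (P + Q))\<^sup>2 \<le> s\<^sup>2 + B / 4 * (P - Q)\<^sup>2 + (m\<^sup>2 - B) / 4 * (P + Q)\<^sup>2"
    using le sq unfolding split[of "\<lambda>x. (Im x)\<^sup>2"] Imu bP cP by linarith
  \<comment> \<open>The left side is what remains of the original form at the imaginary parts once
    its nonnegative part \<open>s^2 - (\<Sum>i<d. (Im (t i))^2)\<close> is dropped.\<close>
  then have "m * (P + Q) * s + B * P * Q \<le> 0"
    by (simp add: power2_eq_square field_simps)
  moreover have "m * (P + Q) * s > 0" using m PQ spos by simp
  moreover have "B * P * Q \<ge> 0" using B PQ by simp
  ultimately show False by linarith
qed

section \<open>Logarithmic derivatives\<close>

text \<open>Here \<open>S = P'/P\<close>, and the second formula is
  \<open>P''/P = (P'/P)^2 + (P'/P)'\<close>. The induction splits off one linear factor at a time by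
  the product rule.\<close>

lemma
  fixes as :: "complex list" and z :: complex
  assumes "z \<notin> set as"
  defines "P \<equiv> \<Prod>a\<leftarrow>as. [:- a, 1:]"
    and "S \<equiv> \<Sum>a\<leftarrow>as. 1 / (z - a)"
  shows poly_pderiv_prod_linear: "poly (pderiv P) z = poly P z * S"
    and poly_pderiv2_prod_linear:
      "poly (pderiv (pderiv P)) z = poly P z * (S\<^sup>2 - (\<Sum>a\<leftarrow>as. (1 / (z - a))\<^sup>2))"
proof -
  have "poly (pderiv P) z = poly P z * S \<and>
      poly (pderiv (pderiv P)) z = poly P z * (S\<^sup>2 - (\<Sum>a\<leftarrow>as. (1 / (z - a))\<^sup>2))"
    using assms(1) unfolding P_def S_def
  proof (induction as)
    case Nil
    then show ?case by simp
  next
    case (Cons a as)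
    define Q where "Q = (\<Prod>a\<leftarrow>as. [:- a, 1:])"
    define s where "s = (\<Sum>a\<leftarrow>as. 1 / (z - a))"
    define r where "r = (\<Sum>a\<leftarrow>as. (1 / (z - a))\<^sup>2)"
    have za: "z - a \<noteq> 0" using Cons.prems by auto
    have IH: "poly (pderiv Q) z = poly Q z * s"
      "poly (pderiv (pderiv Q)) z = poly Q z * (s\<^sup>2 - r)"
      using Cons by (auto simp: Q_def s_def r_def)
    have "poly (pderiv ([:- a, 1:] * Q)) z = poly ([:- a, 1:] * Q) z * (1 / (z - a) + s)"
      using za by (simp add: pderiv_mult pderiv_pCons IH del: mult_pCons_left)
        (simp add: field_simps)
    moreover have "poly (pderiv (pderiv ([:- a, 1:] * Q))) z =
        poly ([:- a, 1:] * Q) z * ((1 / (z - a) + s)\<^sup>2 - ((1 / (z - a))\<^sup>2 + r))"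
    proof -
      have "poly (pderiv (pderiv ([:- a, 1:] * Q))) z
          = (z - a) * (poly Q z * (s\<^sup>2 - r)) + 2 * (poly Q z * s)"
        by (simp add: pderiv_mult pderiv_add pderiv_pCons IH del: mult_pCons_left)
      moreover have "(z - a) * (1 / (z - a)) = 1" using za by simp
      then have "(z - a) * (poly Q z * (s\<^sup>2 - r)) + 2 * (poly Q z * s)
          = (z - a) * poly Q z * ((1 / (z - a) + s)\<^sup>2 - ((1 / (z - a))\<^sup>2 + r))"
        by algebra
      ultimately show ?thesis by (simp del: mult_pCons_left)
    qed
    ultimately show ?case
      by (simp add: Q_def s_def r_def del: mult_pCons_left)
  qed
  then show "poly (pderiv P) z = poly P z * S"
    and "poly (pderiv (pderiv P)) z = poly P z * (S\<^sup>2 - (\<Sum>a\<leftarrow>as. (1 / (z - a))\<^sup>2))"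
    by auto
qed

lemma poly_prod_linear: "poly (\<Prod>a\<leftarrow>as. [:- a, 1:]) z = (\<Prod>a\<leftarrow>as. z - a)"
  for z :: "'a::comm_ring_1"
  by (induction as) (simp_all add: algebra_simps)

section \<open>Hyperbolic polynomials\<close>

abbreviation cpoly :: "real poly \<Rightarrow> complex poly" where
  "cpoly \<equiv> map_poly complex_of_real"

lemma cpoly_add: "cpoly (p + q) = cpoly p + cpoly q"
  by (simp add: poly_eq_iff coeff_map_poly)

lemma cpoly_mult: "cpoly (p * q) = cpoly p * cpoly q"
  by (simp add: poly_eq_iff coeff_map_poly coeff_mult)

lemma cpoly_smult: "cpoly (smult c p) = smult (of_real c) (cpoly p)"
  by (simp add: poly_eq_iff coeff_map_poly)

lemma cpoly_pderiv: "cpoly (pderiv p) = pderiv (cpoly p)"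
  by (simp add: poly_eq_iff coeff_map_poly coeff_pderiv)

lemma poly_cpoly_cnj: "poly (cpoly p) (cnj z) = cnj (poly (cpoly p) z)"
  by (simp add: poly_cnj map_poly_map_poly o_def)

text \<open>Real coefficients make the zeros symmetric under conjugation, so the upper half-plane
  suffices.\<close>

lemma hyperbolicI:
  assumes "\<And>z. Im z > 0 \<Longrightarrow> poly (cpoly p) z \<noteq> 0"
  shows "hyperbolic p"
  unfolding hyperbolic_def
proof (intro disjI2 allI impI)
  fix z assume z: "poly (cpoly p) z = 0"
  then have "poly (cpoly p) (cnj z) = 0" by (simp add: poly_cpoly_cnj)
  then have "\<not> Im (cnj z) > 0" "\<not> Im z > 0" using z assms by blast+
  then have "Im z = 0" by simp
  then show "z \<in> \<real>" by (simp add: complex_is_Real_iff)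
qed

lemma hyperbolic_root_list:
  assumes "hyperbolic p" "p \<noteq> 0"
  obtains c as where "c \<noteq> 0" "cpoly p = smult c (\<Prod>a\<leftarrow>as. [:- a, 1:])"
    "\<And>a. a \<in> set as \<Longrightarrow> Im a = 0" "length as = degree p"
proof -
  obtain as where as: "mset as = proots (cpoly p)" using ex_mset by blast
  have nz: "cpoly p \<noteq> 0" using assms(2) by (simp add: map_poly_eq_0_iff)
  have eq: "cpoly p = smult (lead_coeff (cpoly p)) (\<Prod>a\<leftarrow>as. [:- a, 1:])"
    using complex_poly_decompose_multiset[of "cpoly p"]
    by (simp flip: as prod_mset_prod_list mset_map)
  have im: "Im a = 0" if "a \<in> set as" for a
  proof -
    have "a \<in># proots (cpoly p)" using that by (simp flip: as)
    then have "poly (cpoly p) a = 0" using nz by simp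
    then show ?thesis using assms by (auto simp: hyperbolic_def complex_is_Real_iff)
  qed
  have "length as = size (proots (cpoly p))" by (simp flip: as)
  also have "\<dots> = degree p"
    using nz by (simp add: size_proots_complex degree_map_poly)
  finally have len: "length as = degree p" .
  show ?thesis by (rule that[OF _ eq im len]) (use nz in auto)
qed

text \<open>The \<open>t i\<close> are the reciprocals of \<open>z - a\<close> over the real roots
  \<open>a\<close>, with multiplicity; inversion sends the upper half-plane to the lower
  one.\<close>

lemma hyperbolic_log_derivs:
  assumes "hyperbolic p" "degree p > 0" "Im z > 0"
  obtains t :: "nat \<Rightarrow> complex" where "\<And>i. i < degree p \<Longrightarrow> Im (t i) < 0"
    "poly (cpoly p) z \<noteq> 0"
    "poly (cpoly (pderiv p)) z = poly (cpoly p) z * (\<Sum>i<degree p. t i)"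
    "poly (cpoly (pderiv (pderiv p))) z =
       poly (cpoly p) z * ((\<Sum>i<degree p. t i)\<^sup>2 - (\<Sum>i<degree p. (t i)\<^sup>2))"
proof -
  have "p \<noteq> 0" using assms(2) by auto
  then obtain c as where c: "c \<noteq> 0" "cpoly p = smult c (\<Prod>a\<leftarrow>as. [:- a, 1:])"
    and im: "\<And>a. a \<in> set as \<Longrightarrow> Im a = 0" and len: "length as = degree p"
    using hyperbolic_root_list assms(1) by metis
  have z: "z \<notin> set as" using im assms(3) by force
  define t where "t i = 1 / (z - as ! i)" for i
  have sum: "(\<Sum>a\<leftarrow>as. g (1 / (z - a))) = (\<Sum>i<degree p. g (t i))" for g :: "complex \<Rightarrow> complex"
    by (simp add: sum_list_sum_nth t_def len atLeast0LessThan)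
  show ?thesis
  proof
    fix i assume "i < degree p"
    then have "Im (z - as ! i) > 0" using im[of "as ! i"] len assms(3) by simp
    then show "Im (t i) < 0" unfolding t_def Im_divide
      by (simp add: divide_neg_pos sum_power2_gt_zero_iff)
  next
    show "poly (cpoly p) z \<noteq> 0"
      using z c by (auto simp: poly_prod_linear prod_list_zero_iff)
  next
    show "poly (cpoly (pderiv p)) z = poly (cpoly p) z * (\<Sum>i<degree p. t i)"
      using poly_pderiv_prod_linear[OF z] sum[of "\<lambda>x. x"]
      by (simp add: cpoly_pderiv c(2) pderiv_smult)
    show "poly (cpoly (pderiv (pderiv p))) z =
       poly (cpoly p) z * ((\<Sum>i<degree p. t i)\<^sup>2 - (\<Sum>i<degree p. (t i)\<^sup>2))"
      using poly_pderiv2_prod_linear[OF z] sum[of "\<lambda>x. x"] sum[of "\<lambda>x. x\<^sup>2"]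
      by (simp add: cpoly_pderiv c(2) pderiv_smult)
  qed
qed

lemma hyperbolic_const: "degree p = 0 \<Longrightarrow> hyperbolic p"
  by (elim degree_eq_zeroE) (simp add: hyperbolic_def map_poly_pCons)

text \<open>As in Gauss-Lucas, a nonempty sum of numbers in the open lower half-plane cannot
  vanish.\<close>

lemma hyperbolic_pderiv:
  assumes "hyperbolic p"
  shows "hyperbolic (pderiv p)"
proof (cases "degree p = 0")
  case True
  then show ?thesis by (simp add: hyperbolic_const degree_pderiv)
next
  case False
  then have deg: "degree p > 0" by simp
  show ?thesis
  proof (rule hyperbolicI)
    fix z :: complex assume "Im z > 0"
    from hyperbolic_log_derivs[OF assms deg this] obtain t
      where t: "\<And>i. i < degree p \<Longrightarrow> Im (t i) < 0" and nz: "poly (cpoly p) z \<noteq> 0"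
        and eq: "poly (cpoly (pderiv p)) z = poly (cpoly p) z * (\<Sum>i<degree p. t i)"
      by metis
    have "0 < (\<Sum>i<degree p. - Im (t i))"
      using deg t by (intro sum_pos) auto
    then have "Im (\<Sum>i<degree p. t i) \<noteq> 0" by (simp add: sum_negf)
    then have "(\<Sum>i<degree p. t i) \<noteq> 0" by (metis zero_complex.sel(2))
    then show "poly (cpoly (pderiv p)) z \<noteq> 0" using nz eq by simp
  qed
qed

lemma hyperbolic_higher_pderiv: "hyperbolic p \<Longrightarrow> hyperbolic ((pderiv ^^ n) p)"
  by (induction n) (auto intro: hyperbolic_pderiv)

lemma hyperbolic_mult: "hyperbolic p \<Longrightarrow> hyperbolic q \<Longrightarrow> hyperbolic (p * q)"
  by (auto simp: hyperbolic_def cpoly_mult)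

lemma hyperbolic_power: "hyperbolic p \<Longrightarrow> hyperbolic (p ^ n)"
  by (induction n) (auto intro: hyperbolic_mult hyperbolic_const)

lemma hyperbolic_square_minus_one: "hyperbolic [:-1, 0, 1:]"
proof -
  have "[:-1, 0, 1:] = [:-1, 1:] * [:1, 1 :: real:]" by simp
  moreover have "hyperbolic [:a, 1:]" for a :: real
    by (rule hyperbolicI) (auto simp: map_poly_pCons complex_eq_iff)
  ultimately show ?thesis by (metis hyperbolic_mult)
qed

section \<open>The second-order operator\<close>

text \<open>Up to sign, the left side of the Gegenbauer equation with parameter
  \<open>m - 1/2\<close>. The case \<open>m = 1\<close>, \<open>B = - A\<close> is \<delta> -
  A.\<close>

definition gegenbauer_op :: "real \<Rightarrow> real \<Rightarrow> real poly \<Rightarrow> real poly" where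
  "gegenbauer_op m B f =
     [:-1, 0, 1:] * pderiv (pderiv f) + smult (2 * m) ([:0, 1:] * pderiv f) + smult B f"

lemma hyperbolic_gegenbauer_op:
  assumes m: "m > 0" and B: "0 \<le> B" "B \<le> m\<^sup>2" and f: "hyperbolic f"
  shows "hyperbolic (gegenbauer_op m B f)"
proof (cases "degree f = 0")
  case True
  then have "pderiv f = 0" by (simp add: pderiv_eq_0_iff)
  then have "gegenbauer_op m B f = smult B f" by (simp add: gegenbauer_op_def)
  then show ?thesis using True by (simp add: hyperbolic_const)
next
  case False
  then have deg: "degree f > 0" by simp
  show ?thesis
  proof (rule hyperbolicI)
    fix z :: complex assume z: "Im z > 0"
    from hyperbolic_log_derivs[OF f deg this] obtain t
      where t: "\<And>i. i < degree f \<Longrightarrow> Im (t i) < 0" and nz: "poly (cpoly f) z \<noteq> 0"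
        and d1: "poly (cpoly (pderiv f)) z = poly (cpoly f) z * (\<Sum>i<degree f. t i)"
        and d2: "poly (cpoly (pderiv (pderiv f))) z =
          poly (cpoly f) z * ((\<Sum>i<degree f. t i)\<^sup>2 - (\<Sum>i<degree f. (t i)\<^sup>2))"
      by metis
    define S R where "S = (\<Sum>i<degree f. t i)" and "R = (\<Sum>i<degree f. (t i)\<^sup>2)"
    define p q where "p = 1 / (z - 1)" and "q = 1 / (z + 1)"
    have z1: "z - 1 \<noteq> 0" "z + 1 \<noteq> 0" using z by (auto simp: complex_eq_iff)
    have "Im p < 0" "Im q < 0"
      using z unfolding p_def q_def Im_divide
      by (auto simp: divide_neg_pos sum_power2_gt_zero_iff)
    from quadratic_form_nonzero_lower_half_plane[OF deg t this m B]
    have form: "S\<^sup>2 - R + m * (p + q) * S + B * p * q \<noteq> 0"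
      by (simp add: S_def R_def)
    \<comment> \<open>These identities turn the symmetric form in \<open>p\<close> and
      \<open>q\<close> back into the coefficients of the operator after multiplication by
      \<open>z^2 - 1\<close>.\<close>
    have "p + q = 2 * z * (p * q)" and pq: "(z\<^sup>2 - 1) * (p * q) = 1"
      using z1 unfolding p_def q_def
      by (simp_all add: divide_simps power2_eq_square) (simp_all add: algebra_simps)
    have "(z\<^sup>2 - 1) * (S\<^sup>2 - R + m * (p + q) * S + B * p * q)
        = (z\<^sup>2 - 1) * (S\<^sup>2 - R) + (2 * m * z * S + B) * ((z\<^sup>2 - 1) * (p * q))"
      unfolding \<open>p + q = _\<close> by (simp add: algebra_simps)
    also have "\<dots> = (z\<^sup>2 - 1) * (S\<^sup>2 - R) + 2 * m * z * S + B"
      unfolding pq by simp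
    finally have "(z\<^sup>2 - 1) * (S\<^sup>2 - R) + 2 * m * z * S + B \<noteq> 0"
      using form pq by (metis mult_eq_0_iff mult_zero_left zero_neq_one)
    moreover have "poly (cpoly (gegenbauer_op m B f)) z
        = poly (cpoly f) z * ((z\<^sup>2 - 1) * (S\<^sup>2 - R) + 2 * m * z * S + B)"
      unfolding gegenbauer_op_def cpoly_add cpoly_mult cpoly_smult poly_add poly_mult poly_smult
        d1 d2 S_def[symmetric] R_def[symmetric]
      by (simp add: map_poly_pCons power2_eq_square algebra_simps)
    ultimately show "poly (cpoly (gegenbauer_op m B f)) z \<noteq> 0" using nz by simp
  qed
qed

text \<open>Differentiating \<open>x^2 - 1\<close> gives an extra \<open>2 x f''\<close>, raising
  \<open>m\<close> by 1; differentiating \<open>2 m x\<close> gives \<open>2 m f'\<close>, raising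
  \<open>B\<close> by \<open>2 m\<close>.\<close>

lemma pderiv_gegenbauer_op:
  "pderiv (gegenbauer_op m B f) = gegenbauer_op (m + 1) (B + 2 * m) (pderiv f)"
proof -
  have "poly (pderiv (gegenbauer_op m B f)) x
      = poly (gegenbauer_op (m + 1) (B + 2 * m) (pderiv f)) x" for x
    unfolding gegenbauer_op_def pderiv_add pderiv_mult pderiv_smult
    by (simp add: pderiv_pCons algebra_simps del: mult_pCons_left)
  then show ?thesis by (simp add: poly_eq_poly_eq_iff[symmetric] fun_eq_iff)
qed

text \<open>From \<open>m = 1\<close> and \<open>B = - A\<close>, the increments of \<open>B\<close>
  add up to \<open>2 (1 + ... + n) = n (n + 1)\<close>.\<close>

lemma higher_pderiv_delta_minus:
  "(pderiv ^^ n) (delta_minus A p) =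
     gegenbauer_op (real n + 1) (real n * (real n + 1) - A) ((pderiv ^^ n) p)"
proof (induction n)
  case 0
  then show ?case
    by (simp add: gegenbauer_op_def delta_minus_def legendre_op_def)
next
  case (Suc n)
  then show ?case by (simp add: pderiv_gegenbauer_op algebra_simps)
qed

text \<open>For \<open>B = 0\<close>, the power \<open>(x^2 - 1)^n\<close> is the integrating factor
  that brings the operator to divergence form.\<close>

lemma power_mult_gegenbauer_op:
  "[:-1, 0, 1:] ^ n * gegenbauer_op (real n + 1) 0 f =
     pderiv ([:-1, 0, 1:] ^ Suc n * pderiv f)"
proof -
  have "poly ([:-1, 0, 1:] ^ n * gegenbauer_op (real n + 1) 0 f) x
      = poly (pderiv ([:-1, 0, 1:] ^ Suc n * pderiv f)) x" for x
    unfolding pderiv_mult pderiv_power_Suc gegenbauer_op_def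
    by (simp add: pderiv_pCons poly_power algebra_simps del: mult_pCons_left mult_pCons_right)
  then show ?thesis by (simp add: poly_eq_poly_eq_iff[symmetric] fun_eq_iff)
qed

section \<open>Products of shifted Legendre operators\<close>

lemma op_prod_delta_minus_eq:
  "op_prod (map (\<lambda>i. delta_minus (real i * (real i + 1))) [0..<n]) p =
     (pderiv ^^ n) ([:-1, 0, 1:] ^ n * (pderiv ^^ n) p)"
proof (induction n arbitrary: p)
  case 0
  then show ?case by (simp add: op_prod_def)
next
  case (Suc n)
  have snoc: "op_prod (Ts @ [T]) p = op_prod Ts (T p)" for Ts and T :: "real poly \<Rightarrow> real poly"
    unfolding op_prod_def by (induction Ts) auto
  \<comment> \<open>The last factor acts first. Moving \<open>D^n\<close> past it gives
    \<open>B = 0\<close>, so the divergence form supplies one more derivative on each side.\<close>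
  have "op_prod (map (\<lambda>i. delta_minus (real i * (real i + 1))) [0..<Suc n]) p
      = op_prod (map (\<lambda>i. delta_minus (real i * (real i + 1))) [0..<n])
          (delta_minus (real n * (real n + 1)) p)"
    by (simp add: snoc)
  also have "\<dots> = (pderiv ^^ n) ([:-1, 0, 1:] ^ n * gegenbauer_op (real n + 1) 0 ((pderiv ^^ n) p))"
    unfolding Suc.IH higher_pderiv_delta_minus by simp
  also have "\<dots> = (pderiv ^^ Suc n) ([:-1, 0, 1:] ^ Suc n * (pderiv ^^ Suc n) p)"
    unfolding power_mult_gegenbauer_op by (simp add: funpow_swap1)
  finally show ?case .
qed

lemma hyperbolic_higher_pderiv_op_prod:
  assumes "\<And>A. A \<in> set As \<Longrightarrow> - (real n + 1) \<le> A \<and> A \<le> real n * (real n + 1)"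
    and "hyperbolic p"
  shows "hyperbolic ((pderiv ^^ n) (op_prod (map delta_minus As) p))"
  using assms(1)
proof (induction As)
  case Nil
  then show ?case using assms(2) by (simp add: op_prod_def hyperbolic_higher_pderiv)
next
  case (Cons A As)
  \<comment> \<open>The lower bound on \<open>A\<close> enters through
    \<open>n (n + 1) + (n + 1) = (n + 1)^2\<close>.\<close>
  have "real n * (real n + 1) - A \<ge> 0" "real n * (real n + 1) - A \<le> (real n + 1)\<^sup>2"
    using Cons.prems[of A] by (auto simp: power2_eq_square algebra_simps)
  moreover have "hyperbolic ((pderiv ^^ n) (op_prod (map delta_minus As) p))"
    using Cons by auto
  ultimately have "hyperbolic ((pderiv ^^ n) (delta_minus A (op_prod (map delta_minus As) p)))"
    unfolding higher_pderiv_delta_minus by (intro hyperbolic_gegenbauer_op) auto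
  then show ?case by (simp add: op_prod_def)
qed

theorem theorem4:
  fixes n N :: nat and A :: "nat \<Rightarrow> real"
  assumes "n \<ge> 1" and "N \<ge> 1"
    and "\<And>j. j \<in> {1..N} \<Longrightarrow> - (real n + 1) \<le> A j \<and> A j \<le> real n * (real n + 1)"
  shows "hyperbolicity_preserver
           (op_prod (map (\<lambda>i. delta_minus (real i * (real i + 1))) [0..<n])
            \<circ> op_prod (map (\<lambda>j. delta_minus (A j)) [1..<Suc N]))"
  unfolding hyperbolicity_preserver_def o_apply op_prod_delta_minus_eq
proof (intro allI impI)
  fix p assume p: "hyperbolic p"
  have "hyperbolic ((pderiv ^^ n) (op_prod (map delta_minus (map A [1..<Suc N])) p))"
    by (rule hyperbolic_higher_pderiv_op_prod[OF _ p]) (use assms(3) in auto)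
  then have "hyperbolic ((pderiv ^^ n) (op_prod (map (\<lambda>j. delta_minus (A j)) [1..<Suc N]) p))"
    by (simp add: o_def del: upt_Suc)
  then show "hyperbolic ((pderiv ^^ n) ([:-1, 0, 1:] ^ n *
      (pderiv ^^ n) (op_prod (map (\<lambda>j. delta_minus (A j)) [1..<Suc N]) p)))"
    by (rule hyperbolic_higher_pderiv[OF hyperbolic_mult[OF hyperbolic_power[OF hyperbolic_square_minus_one]]])
qed

end
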